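(* Let $n\ge1$ and let $f(z,\overline z)$ be a real-valued polynomial of degree $m$ in $z$ and $\overline z$ on $\mathbf{C}^n$ (not necessarily homogeneous) such that $f(z,\overline z)>0$ for all $z$ on the unit sphere $\{\|z\|=1\}$. Then there is an integer $N\ge1$ and a holomorphic polynomial mapping $g:\mathbf{C}^n\to\mathbf{C}^N$ such that $f(z,\overline z)=\|g(z)\|^2$ for all $z$ on the unit sphere.
   Context: $\|\cdot\|$ denotes the complex Euclidean norm. A polynomial in $z$ and $\overline z$ is a finite sum $\sum c_{\alpha\beta}z^\alpha\overline z^\beta$ with complex coefficients, $\alpha,\beta$ multi-indices. *)

theory Defs
  imports "HOL-Analysis.Analysis" "HOL-Library.Poly_Mapping"
begin

text \<open>Multi-indices on \<open>\<complex>\<^sup>n\<close>, with \<open>n = CARD('n)\<close>, are functions \<open>'n \<Rightarrow> nat\<close>.\<close>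

type_synonym 'n multi_index = "'n \<Rightarrow> nat"

definition mi_degree :: "'n::finite multi_index \<Rightarrow> nat" where
  "mi_degree \<alpha> = (\<Sum>i\<in>UNIV. \<alpha> i)"

definition monomial_at :: "complex ^ 'n \<Rightarrow> 'n::finite multi_index \<Rightarrow> complex" where
  "monomial_at z \<alpha> = (\<Prod>i\<in>UNIV. (z $ i) ^ \<alpha> i)"

definition conj_vec :: "complex ^ 'n \<Rightarrow> complex ^ 'n::finite" where
  "conj_vec z = (\<chi> i. cnj (z $ i))"

text \<open>A polynomial in \<open>z\<close> and \<open>conj z\<close> is its finitely supported coefficient family
  \<open>(\<alpha>, \<beta>) \<mapsto> c\<^bsub>\<alpha>\<beta>\<^esub>\<close>.\<close>

type_synonym 'n zzbar_poly = "('n multi_index \<times> 'n multi_index) \<Rightarrow>\<^sub>0 complex"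

definition zzbar_eval :: "'n::finite zzbar_poly \<Rightarrow> complex ^ 'n \<Rightarrow> complex" where
  "zzbar_eval f z =
    (\<Sum>(\<alpha>, \<beta>)\<in>Poly_Mapping.keys f.
      Poly_Mapping.lookup f (\<alpha>, \<beta>) * monomial_at z \<alpha> * monomial_at (conj_vec z) \<beta>)"

text \<open>Total degree in \<open>z\<close> and \<open>conj z\<close> jointly; the zero polynomial gets degree 0.\<close>

definition zzbar_degree :: "'n::finite zzbar_poly \<Rightarrow> nat" where
  "zzbar_degree f =
    Max (insert 0 ((\<lambda>(\<alpha>, \<beta>). mi_degree \<alpha> + mi_degree \<beta>) ` Poly_Mapping.keys f))"

definition zzbar_real_valued :: "'n::finite zzbar_poly \<Rightarrow> bool" where
  "zzbar_real_valued f \<longleftrightarrow> (\<forall>z. zzbar_eval f z \<in> \<real>)"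

definition hol_poly_fun :: "(complex ^ 'n::finite \<Rightarrow> complex) \<Rightarrow> bool" where
  "hol_poly_fun h \<longleftrightarrow>
    (\<exists>c :: 'n multi_index \<Rightarrow>\<^sub>0 complex.
      \<forall>z. h z = (\<Sum>\<alpha>\<in>Poly_Mapping.keys c. Poly_Mapping.lookup c \<alpha> * monomial_at z \<alpha>))"

text \<open>As \<open>N\<close> is existentially quantified in the theorem, a vector of \<open>\<complex>\<^sup>N\<close> is a function
  \<open>nat \<Rightarrow> complex\<close> of which only the values at \<open>0, \<dots>, N - 1\<close> are considered.\<close>

definition hol_poly_map :: "nat \<Rightarrow> (complex ^ 'n::finite \<Rightarrow> nat \<Rightarrow> complex) \<Rightarrow> bool" where
  "hol_poly_map N g \<longleftrightarrow> (\<forall>j<N. hol_poly_fun (\<lambda>z. g z j))"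

definition cnorm :: "nat \<Rightarrow> (nat \<Rightarrow> complex) \<Rightarrow> real" where
  "cnorm N w = L2_set (\<lambda>j. cmod (w j)) {..<N}"

end

theory Submission
  imports Defs "HOL-Library.Function_Algebras"
begin

text \<open>
  The functions which agree on the sphere with some \<open>\<parallel>g\<parallel>\<^sup>2\<close>, \<open>g\<close> a holomorphic polynomial map, form
  a semiring \<open>T\<close>. On the sphere \<open>1 - |z\<^sub>i|\<^sup>2\<close> is the sum of the other \<open>|z\<^sub>j|\<^sup>2\<close>, and
  \<open>2 (1 + Re (u z\<^sub>i)) = |1 + u z\<^sub>i|\<^sup>2 + (1 - |z\<^sub>i|\<^sup>2)\<close> for \<open>|u| = 1\<close>; hence the real coordinates, and
  so all real polynomials, are bounded with respect to \<open>T\<close>. By the Kadison--Dubois theorem, a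
  bounded element which is positive under every \<open>T\<close>-nonnegative character lies in \<open>T\<close>. On
  polynomials, a character is the evaluation at the point whose coordinates are its values at the
  coordinate functions, and this point lies on the sphere because \<open>1 - \<parallel>z\<parallel>\<^sup>2\<close> and its negative
  belong to \<open>T\<close>.
\<close>

section \<open>The Kadison--Dubois theorem\<close>

locale real_semiring =
  fixes T :: "'a::{real_algebra_1, comm_ring_1} set"
  assumes add_mem: "s \<in> T \<Longrightarrow> t \<in> T \<Longrightarrow> s + t \<in> T"
    and mult_mem: "s \<in> T \<Longrightarrow> t \<in> T \<Longrightarrow> s * t \<in> T"
    and of_real_mem: "0 \<le> r \<Longrightarrow> of_real r \<in> T"
begin

definition bounded_elements :: "'a set" where
  "bounded_elements = {a. \<exists>k. of_real k - a \<in> T \<and> of_real k + a \<in> T}"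

abbreviation bounded_cone :: "'a set" where
  "bounded_cone \<equiv> T \<inter> bounded_elements"

lemma zero_mem: "0 \<in> T" and one_mem: "1 \<in> T"
  using of_real_mem[of 0] of_real_mem[of 1] by simp_all

lemma sum_mem: "(\<And>i. i \<in> I \<Longrightarrow> a i \<in> T) \<Longrightarrow> sum a I \<in> T"
  by (induction I rule: infinite_finite_induct) (simp_all add: zero_mem add_mem)

lemma add_of_real_mem_mono:
  assumes "a + of_real r \<in> T" "r \<le> s"
  shows "a + of_real s \<in> T"
  using add_mem[OF assms(1) of_real_mem[of "s - r"]] assms(2) by simp

lemma bounded_elements_obtain_pos:
  assumes "a \<in> bounded_elements"
  obtains k where "0 < k" "of_real k - a \<in> T" "of_real k + a \<in> T"
proof -
  obtain k where "- a + of_real k \<in> T" "a + of_real k \<in> T"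
    using assms unfolding bounded_elements_def by (auto simp: add.commute)
  from this[THEN add_of_real_mem_mono, of "\<bar>k\<bar> + 1"] show thesis
    by (intro that[of "\<bar>k\<bar> + 1"]) (simp_all add: algebra_simps)
qed

lemma bounded_elements_of_real: "of_real r \<in> bounded_elements"
  unfolding bounded_elements_def
  using of_real_mem[of "\<bar>r\<bar> - r"] of_real_mem[of "\<bar>r\<bar> + r"]
  by (intro CollectI exI[of _ "\<bar>r\<bar>"]) simp

lemma bounded_elements_uminus: "a \<in> bounded_elements \<Longrightarrow> - a \<in> bounded_elements"
  unfolding bounded_elements_def by auto

lemma bounded_elements_add:
  assumes "a \<in> bounded_elements" "b \<in> bounded_elements"
  shows "a + b \<in> bounded_elements"
proof -
  obtain k l where
    "of_real k - a \<in> T" "of_real k + a \<in> T" "of_real l - b \<in> T" "of_real l + b \<in> T"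
    using assms unfolding bounded_elements_def by blast
  then have "(of_real k - a) + (of_real l - b) \<in> T" "(of_real k + a) + (of_real l + b) \<in> T"
    by (auto intro: add_mem)
  then show ?thesis
    unfolding bounded_elements_def
    by (intro CollectI exI[of _ "k + l"]) (simp add: algebra_simps)
qed

lemma bounded_elements_diff:
  "a \<in> bounded_elements \<Longrightarrow> b \<in> bounded_elements \<Longrightarrow> a - b \<in> bounded_elements"
  using bounded_elements_add[of a "- b"] bounded_elements_uminus[of b] by simp

lemma bounded_elements_mult:
  assumes "a \<in> bounded_elements" "b \<in> bounded_elements"
  shows "a * b \<in> bounded_elements"
proof -
  obtain k where k: "0 < k" "of_real k - a \<in> T" "of_real k + a \<in> T"
    using assms(1) by (rule bounded_elements_obtain_pos)
  obtain l where l: "0 < l" "of_real l - b \<in> T" "of_real l + b \<in> T"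
    using assms(2) by (rule bounded_elements_obtain_pos)
  have "of_real (3 * (k * l)) + c * b \<in> T"
    if "of_real k - c \<in> T" "of_real k + c \<in> T" for c
  proof -
    have "(of_real k + c) * (of_real l + b) + of_real k * (of_real l - b)
        + of_real l * (of_real k - c) \<in> T"
      using k l that by (auto intro!: add_mem mult_mem of_real_mem)
    then show ?thesis by (simp add: algebra_simps)
  qed
  from this[of a] this[of "- a"] k show ?thesis
    unfolding bounded_elements_def by (intro CollectI exI[of _ "3 * (k * l)"]) simp
qed

lemma bounded_cone_one: "1 \<in> bounded_cone"
  using one_mem bounded_elements_of_real[of 1] by simp

lemma bounded_cone_of_real: "0 \<le> r \<Longrightarrow> of_real r \<in> bounded_cone"
  by (simp add: of_real_mem bounded_elements_of_real)

lemma bounded_cone_add: "s \<in> bounded_cone \<Longrightarrow> t \<in> bounded_cone \<Longrightarrow> s + t \<in> bounded_cone"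
  by (simp add: add_mem bounded_elements_add)

lemma bounded_cone_mult: "s \<in> bounded_cone \<Longrightarrow> t \<in> bounded_cone \<Longrightarrow> s * t \<in> bounded_cone"
  by (simp add: mult_mem bounded_elements_mult)

lemma bounded_cone_upper_bound:
  assumes "a \<in> bounded_elements"
  obtains k where "0 < k" "of_real k - a \<in> bounded_cone"
  using assms bounded_elements_obtain_pos bounded_elements_diff[OF bounded_elements_of_real]
  by (metis IntI)

lemma add_of_real_mem_descend:
  assumes ft: "f * t = 1 + s" and T: "s \<in> T" "t \<in> T" "of_real l - t \<in> T" "f + of_real r \<in> T"
    and "0 < l" "0 \<le> r"
  shows "f + of_real (r - 1 / l) \<in> T"
proof -
  have "(of_real l - t) * (f + of_real r) + s + of_real r * t \<in> T"
    using T \<open>0 \<le> r\<close> by (auto intro!: add_mem mult_mem of_real_mem)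
  also have "(of_real l - t) * (f + of_real r) + s + of_real r * t
      = of_real l * (f + of_real r) - 1"
    using ft by (simp add: algebra_simps)
  finally have "of_real (1 / l) * (of_real l * (f + of_real r) - 1) \<in> T"
    using \<open>0 < l\<close> by (intro mult_mem of_real_mem) auto
  moreover have "of_real (1 / l) * (of_real l * (f + of_real r)) = f + of_real r"
    using \<open>0 < l\<close> by (simp flip: of_real_mult mult.assoc)
  ultimately show ?thesis by (simp add: right_diff_distrib add_diff_eq)
qed

lemma mem_if_mult_eq_one_plus:
  assumes f: "f \<in> bounded_elements" and s: "s \<in> T" and t: "t \<in> bounded_cone"
    and ft: "f * t = 1 + s"
  shows "f \<in> T"
proof -
  obtain l where l: "0 < l" "of_real l - t \<in> T"
    using t bounded_cone_upper_bound by blast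
  obtain k where k: "0 < k" "of_real k + f \<in> T"
    using f by (rule bounded_elements_obtain_pos)
  have "f + of_real (max 0 (k - real j / l)) \<in> T" for j
  proof (induction j)
    case 0
    then show ?case using k by (simp add: add.commute max_def)
  next
    case (Suc j)
    have "real (Suc j) / l = real j / l + 1 / l" "0 < 1 / l"
      using l by (simp_all add: add_divide_distrib)
    then have "max 0 (k - real j / l) - 1 / l \<le> max 0 (k - real (Suc j) / l)"
      by linarith
    moreover have "f + of_real (max 0 (k - real j / l) - 1 / l) \<in> T"
      using add_of_real_mem_descend[OF ft s _ l(2) Suc l(1)] t by simp
    ultimately show ?case by (rule add_of_real_mem_mono[rotated])
  qed
  moreover obtain j :: nat where "k * l \<le> real j"
    using real_arch_simple by blast
  then have "max 0 (k - real j / l) = 0"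
    using l by (simp add: field_simps)
  ultimately show ?thesis by (metis add_0_right of_real_0)
qed

end

text \<open>
  Characters are considered on the subring of bounded elements only. This ring is archimedean with
  respect to \<open>T \<inter> bounded_elements\<close>, so \<open>T\<close> itself need not be.
\<close>

locale nonneg_character = real_semiring T for T :: "'a::{real_algebra_1, comm_ring_1} set" +
  fixes \<phi> :: "'a \<Rightarrow> real"
  assumes character_add:
      "a \<in> bounded_elements \<Longrightarrow> b \<in> bounded_elements \<Longrightarrow> \<phi> (a + b) = \<phi> a + \<phi> b"
    and character_mult:
      "a \<in> bounded_elements \<Longrightarrow> b \<in> bounded_elements \<Longrightarrow> \<phi> (a * b) = \<phi> a * \<phi> b"
    and character_of_real: "\<phi> (of_real r) = r"
    and character_nonneg: "t \<in> bounded_cone \<Longrightarrow> 0 \<le> \<phi> t"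
begin

lemma character_uminus: "a \<in> bounded_elements \<Longrightarrow> \<phi> (- a) = - \<phi> a"
  using character_add[OF _ bounded_elements_uminus, of a a] character_of_real[of 0] by simp

end

locale semiring_module = real_semiring T for T :: "'a::{real_algebra_1, comm_ring_1} set" +
  fixes M :: "'a set"
  assumes module_one: "1 \<in> M"
    and module_add: "x \<in> M \<Longrightarrow> y \<in> M \<Longrightarrow> x + y \<in> M"
    and module_mult: "t \<in> bounded_cone \<Longrightarrow> x \<in> M \<Longrightarrow> t * x \<in> M"
begin

lemma bounded_cone_subset: "bounded_cone \<subseteq> M"
  using module_mult[OF _ module_one] by auto

definition adjoin :: "'a \<Rightarrow> 'a set" where
  "adjoin b = {m + b * t | m t. m \<in> M \<and> t \<in> bounded_cone}"

lemma adjoinI: "m \<in> M \<Longrightarrow> t \<in> bounded_cone \<Longrightarrow> m + b * t \<in> adjoin b"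
  unfolding adjoin_def by blast

lemma subset_adjoin: "M \<subseteq> adjoin b"
  using adjoinI[OF _ bounded_cone_of_real[of 0]] by auto

lemma mem_adjoin: "b \<in> adjoin b"
  using adjoinI[OF _ bounded_cone_one] module_mult[OF bounded_cone_of_real[of 0] module_one]
  by fastforce

lemma semiring_module_adjoin: "semiring_module T (adjoin b)"
proof unfold_locales
  show "1 \<in> adjoin b" using module_one subset_adjoin by blast
next
  fix x y assume "x \<in> adjoin b" "y \<in> adjoin b"
  then obtain m t m' t' where "x = m + b * t" "y = m' + b * t'"
    "m \<in> M" "t \<in> bounded_cone" "m' \<in> M" "t' \<in> bounded_cone"
    unfolding adjoin_def by blast
  then show "x + y \<in> adjoin b"
    using adjoinI[OF module_add[of m m'] bounded_cone_add[of t t']] by (simp add: algebra_simps)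
next
  fix s x assume "s \<in> bounded_cone" "x \<in> adjoin b"
  then obtain m t where "x = m + b * t" "m \<in> M" "t \<in> bounded_cone" "s \<in> bounded_cone"
    unfolding adjoin_def by blast
  then show "s * x \<in> adjoin b"
    using adjoinI[OF module_mult[of s m] bounded_cone_mult[of s t]] by (simp add: algebra_simps)
qed

lemma adjoin_proper:
  assumes a: "a \<in> bounded_elements" and "- 1 \<notin> M"
  shows "- 1 \<notin> adjoin a \<or> - 1 \<notin> adjoin (- a)"
proof (rule ccontr)
  assume "\<not> ?thesis"
  then obtain m t n u where m: "m \<in> M" and t: "t \<in> bounded_cone" and n: "n \<in> M"
    and u: "u \<in> bounded_cone" and "- 1 = m + a * t" and "- 1 = n + (- a) * u"
    unfolding adjoin_def by blast
  have at: "a * t = - 1 - m"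
    using \<open>- 1 = m + a * t\<close> by (simp add: eq_diff_eq add.commute)
  have au: "a * u = 1 + n"
    using \<open>- 1 = n + (- a) * u\<close> by (simp add: minus_equation_iff[of 1] algebra_simps)
  \<comment> \<open>Eliminating \<open>a\<close> from the two representations of \<open>- 1\<close> shows \<open>- t \<in> M\<close>.\<close>
  have "- t - (u * m + t * n + u) = u * (a * t) - t * (a * u)"
    unfolding at au by (simp add: algebra_simps)
  also have "\<dots> = 0" by (simp add: mult_ac)
  finally have "- t = u * m + t * n + u" by simp
  then have neg_t: "- t \<in> M"
    using m n t u bounded_cone_subset by (auto intro!: module_add module_mult)
  obtain k where k: "0 < k" "of_real k - a \<in> bounded_cone"
    using a by (rule bounded_cone_upper_bound)
  have "(of_real k - a) * (- t) \<in> M"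
    using k neg_t module_mult by blast
  moreover have "of_real k * t \<in> M"
    using bounded_cone_mult[OF bounded_cone_of_real t] k bounded_cone_subset by auto
  ultimately have "(of_real k - a) * (- t) + of_real k * t + m \<in> M"
    using m by (intro module_add)
  also have "(of_real k - a) * (- t) + of_real k * t + m = - 1"
    using at by (simp add: algebra_simps)
  finally show False using assms(2) by contradiction
qed

end

text \<open>
  In a total module, \<open>b - a \<in> M\<close> defines a total preorder \<open>a \<le> b\<close> on the bounded elements, with
  respect to which infinitesimals and standard parts are taken.
\<close>

locale total_module = semiring_module +
  assumes proper: "- 1 \<notin> M"
    and total: "a \<in> bounded_elements \<Longrightarrow> a \<in> M \<or> - a \<in> M"
begin

lemma of_real_mem_module_iff: "of_real r \<in> M \<longleftrightarrow> 0 \<le> r"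
proof
  assume "of_real r \<in> M"
  then have "of_real (1 / (- r)) * of_real r \<in> M" if "r < 0"
    using that by (intro module_mult bounded_cone_of_real) auto
  moreover have "of_real (1 / (- r)) * of_real r = (- 1 :: 'a)" if "r < 0"
    using that by (simp flip: of_real_mult)
  ultimately show "0 \<le> r"
    using proper by (metis not_le)
qed (use bounded_cone_of_real bounded_cone_subset in blast)

definition infinitesimal :: "'a \<Rightarrow> bool" where
  "infinitesimal a \<longleftrightarrow> (\<forall>e>0. of_real e + a \<in> M \<and> of_real e - a \<in> M)"

lemma infinitesimal_uminus: "infinitesimal a \<Longrightarrow> infinitesimal (- a)"
  unfolding infinitesimal_def by simp

lemma infinitesimal_add:
  assumes "infinitesimal a" "infinitesimal b"
  shows "infinitesimal (a + b)"
  unfolding infinitesimal_def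
proof (intro allI impI)
  fix e :: real assume "e > 0"
  then have "of_real (e/2) + a \<in> M" "of_real (e/2) + b \<in> M"
    "of_real (e/2) - a \<in> M" "of_real (e/2) - b \<in> M"
    using assms half_gt_zero[of e] unfolding infinitesimal_def by blast+
  then have "(of_real (e/2) + a) + (of_real (e/2) + b) \<in> M"
    "(of_real (e/2) - a) + (of_real (e/2) - b) \<in> M"
    by (simp_all only: module_add)
  moreover have "of_real e = (of_real (e/2) + of_real (e/2) :: 'a)"
    by (simp flip: of_real_add)
  ultimately show "of_real e + (a + b) \<in> M \<and> of_real e - (a + b) \<in> M"
    by (simp add: algebra_simps)
qed

lemma infinitesimal_mult_cone:
  assumes t: "t \<in> bounded_cone" and a: "infinitesimal a"
  shows "infinitesimal (t * a)"
  unfolding infinitesimal_def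
proof (intro allI impI)
  fix e :: real assume e: "e > 0"
  obtain l where l: "0 < l" "of_real l - t \<in> bounded_cone"
    using t bounded_cone_upper_bound by blast
  have "t * (of_real (e/l) + a) \<in> M" "t * (of_real (e/l) - a) \<in> M"
    using a e l t unfolding infinitesimal_def by (auto intro!: module_mult)
  moreover have "of_real (e/l) * (of_real l - t) \<in> M"
    using l e bounded_cone_mult[OF bounded_cone_of_real] bounded_cone_subset
    by (simp add: subset_iff)
  ultimately have "t * (of_real (e/l) + a) + of_real (e/l) * (of_real l - t) \<in> M"
    "t * (of_real (e/l) - a) + of_real (e/l) * (of_real l - t) \<in> M"
    using module_add by blast+
  moreover have "of_real (e/l) * of_real l = (of_real e :: 'a)"
    using l by (simp flip: of_real_mult)
  ultimately show "of_real e + t * a \<in> M \<and> of_real e - t * a \<in> M"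
    by (simp add: algebra_simps)
qed

lemma infinitesimal_mult:
  assumes "b \<in> bounded_elements" "infinitesimal a"
  shows "infinitesimal (b * a)"
proof -
  obtain k where k: "0 < k" "of_real k - b \<in> bounded_cone"
    using assms(1) by (rule bounded_cone_upper_bound)
  have "infinitesimal (of_real k * a + - ((of_real k - b) * a))"
    using k assms(2)
    by (intro infinitesimal_add infinitesimal_uminus infinitesimal_mult_cone bounded_cone_of_real)
      auto
  then show ?thesis by (simp add: algebra_simps)
qed

lemma infinitesimal_of_real_iff: "infinitesimal (of_real c) \<longleftrightarrow> c = 0"
proof -
  have "infinitesimal (of_real c) \<longleftrightarrow> (\<forall>e>0. 0 \<le> e + c \<and> 0 \<le> e - c)"
    unfolding infinitesimal_def
    by (simp add: of_real_mem_module_iff flip: of_real_add of_real_diff)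
  also have "\<dots> \<longleftrightarrow> (\<forall>e>0. \<bar>c\<bar> \<le> e)"
    by (auto simp: abs_le_iff)
  also have "\<dots> \<longleftrightarrow> c = 0"
    using dense[of 0 "\<bar>c\<bar>"] by force
  finally show ?thesis .
qed

text \<open>Outside the bounded elements, the supremum may be that of an empty or unbounded set.\<close>

definition standard_part :: "'a \<Rightarrow> real" where
  "standard_part a = Sup {r. a - of_real r \<in> M}"

lemma real_lower_bounds_nonempty:
  assumes "a \<in> bounded_elements"
  shows "{r. a - of_real r \<in> M} \<noteq> {}"
proof -
  obtain k where "of_real k - (- a) \<in> bounded_cone"
    using assms bounded_cone_upper_bound bounded_elements_uminus by metis
  then have "a - of_real (- k) \<in> M"
    using bounded_cone_subset by (auto simp: add.commute)
  then show ?thesis by blast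
qed

lemma real_lower_bounds_bdd_above:
  assumes "a \<in> bounded_elements"
  shows "bdd_above {r. a - of_real r \<in> M}"
proof -
  obtain l where l: "of_real l - a \<in> bounded_cone"
    using assms bounded_cone_upper_bound by blast
  show ?thesis
  proof (rule bdd_aboveI)
    fix r assume "r \<in> {r. a - of_real r \<in> M}"
    then have "(of_real l - a) + (a - of_real r) \<in> M"
      using l bounded_cone_subset by (intro module_add) auto
    then show "r \<le> l"
      using of_real_mem_module_iff[of "l - r"] by simp
  qed
qed

lemma diff_mem_if_less_standard_part:
  assumes "a \<in> bounded_elements" "r < standard_part a"
  shows "a - of_real r \<in> M"
proof -
  obtain s where "r < s" "a - of_real s \<in> M"
    using assms less_cSup_iff[OF real_lower_bounds_nonempty real_lower_bounds_bdd_above]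
    unfolding standard_part_def by blast
  then have "of_real (s - r) + (a - of_real s) \<in> M"
    by (intro module_add) (simp_all only: of_real_mem_module_iff)
  then show ?thesis by simp
qed

lemma diff_mem_if_standard_part_less:
  assumes "a \<in> bounded_elements" "standard_part a < r"
  shows "of_real r - a \<in> M"
proof -
  have "a - of_real r \<notin> M"
    using assms cSup_upper[OF _ real_lower_bounds_bdd_above, of r a]
    unfolding standard_part_def by auto
  then show ?thesis
    using total[OF bounded_elements_diff[OF assms(1) bounded_elements_of_real[of r]]] by simp
qed

lemma infinitesimal_diff_standard_part:
  assumes "a \<in> bounded_elements"
  shows "infinitesimal (a - of_real (standard_part a))"
  unfolding infinitesimal_def
proof (intro allI impI conjI)
  fix e :: real assume "0 < e"
  then show "of_real e + (a - of_real (standard_part a)) \<in> M"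
    using diff_mem_if_less_standard_part[OF assms, of "standard_part a - e"]
    by (simp add: algebra_simps)
  from \<open>0 < e\<close> show "of_real e - (a - of_real (standard_part a)) \<in> M"
    using diff_mem_if_standard_part_less[OF assms, of "standard_part a + e"]
    by (simp add: algebra_simps)
qed

lemma standard_part_eqI:
  assumes "a \<in> bounded_elements" "infinitesimal (a - of_real c)"
  shows "standard_part a = c"
proof -
  have "infinitesimal ((a - of_real c) + - (a - of_real (standard_part a)))"
    using assms
    by (intro infinitesimal_add infinitesimal_uminus infinitesimal_diff_standard_part)
  then show ?thesis
    using infinitesimal_of_real_iff[of "standard_part a - c"] by simp
qed

lemma standard_part_nonneg:
  assumes "a \<in> bounded_elements" "a \<in> M"
  shows "0 \<le> standard_part a"
proof (rule field_le_epsilon)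
  fix e :: real assume "0 < e"
  then have "of_real e - (a - of_real (standard_part a)) \<in> M"
    using infinitesimal_diff_standard_part[OF assms(1)] unfolding infinitesimal_def by blast
  then have "of_real e - (a - of_real (standard_part a)) + a \<in> M"
    using assms(2) by (rule module_add)
  then show "0 \<le> standard_part a + e"
    using of_real_mem_module_iff[of "standard_part a + e"] by (simp add: add.commute)
qed

lemma nonneg_character_standard_part: "nonneg_character T standard_part"
proof unfold_locales
  fix a b assume ab: "a \<in> bounded_elements" "b \<in> bounded_elements"
  note infinitesimal_parts = ab[THEN infinitesimal_diff_standard_part]
  show "standard_part (a + b) = standard_part a + standard_part b"
    using infinitesimal_add[OF infinitesimal_parts]
    by (intro standard_part_eqI bounded_elements_add ab) (simp add: algebra_simps)
  have "infinitesimal (b * (a - of_real (standard_part a))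
      + of_real (standard_part a) * (b - of_real (standard_part b)))"
    by (intro infinitesimal_add infinitesimal_mult infinitesimal_parts ab bounded_elements_of_real)
  then show "standard_part (a * b) = standard_part a * standard_part b"
    by (intro standard_part_eqI bounded_elements_mult ab) (simp add: algebra_simps)
next
  show "standard_part (of_real r) = r" for r
    using infinitesimal_of_real_iff[of 0]
    by (intro standard_part_eqI bounded_elements_of_real) simp
next
  show "0 \<le> standard_part t" if "t \<in> bounded_cone" for t
    using that bounded_cone_subset by (blast intro: standard_part_nonneg)
qed

end

context real_semiring
begin

lemma semiring_module_bounded_cone: "semiring_module T bounded_cone"
  by unfold_locales (rule bounded_cone_one bounded_cone_add bounded_cone_mult; assumption)+

lemma semiring_module_Union_chain:
  assumes "subset.chain {M. semiring_module T M} \<C>" "\<C> \<noteq> {}"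
  shows "semiring_module T (\<Union>\<C>)"
proof unfold_locales
  have modules: "semiring_module T M" if "M \<in> \<C>" for M
    using assms(1) that unfolding subset_chain_def by blast
  show "1 \<in> \<Union>\<C>"
    using assms(2) semiring_module.module_one[OF modules] by blast
  show "t * x \<in> \<Union>\<C>" if "t \<in> bounded_cone" "x \<in> \<Union>\<C>" for t x
    using that semiring_module.module_mult[OF modules] by blast
  fix x y assume "x \<in> \<Union>\<C>" "y \<in> \<Union>\<C>"
  then obtain M where "M \<in> \<C>" "x \<in> M" "y \<in> M"
    using assms(1) unfolding subset_chain_def by blast
  then show "x + y \<in> \<Union>\<C>"
    using semiring_module.module_add[OF modules] by blast
qed

lemma proper_module_extends_to_total_module:
  assumes "semiring_module T M\<^sub>0" "- 1 \<notin> M\<^sub>0"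
  obtains M where "M\<^sub>0 \<subseteq> M" "total_module T M"
proof -
  define proper_above where "proper_above = {M. semiring_module T M \<and> - 1 \<notin> M \<and> M\<^sub>0 \<subseteq> M}"
  have "\<exists>M\<in>proper_above. \<forall>X\<in>proper_above. M \<subseteq> X \<longrightarrow> X = M"
  proof (rule subset_Zorn_nonempty)
    show "proper_above \<noteq> {}"
      using assms unfolding proper_above_def by blast
    fix \<C> assume \<C>: "\<C> \<noteq> {}" "subset.chain proper_above \<C>"
    then have "semiring_module T (\<Union>\<C>)"
      by (intro semiring_module_Union_chain) (auto simp: subset_chain_def proper_above_def)
    then show "\<Union>\<C> \<in> proper_above"
      using \<C> unfolding proper_above_def subset_chain_def by blast
  qed
  then obtain M where M: "M \<in> proper_above"
    and maximal: "\<And>X. X \<in> proper_above \<Longrightarrow> M \<subseteq> X \<Longrightarrow> X = M"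
    by blast
  interpret semiring_module T M using M unfolding proper_above_def by blast
  have adjoin_mem: "b \<in> M" if "- 1 \<notin> adjoin b" for b
  proof -
    have "adjoin b \<in> proper_above"
      using M that subset_adjoin semiring_module_adjoin unfolding proper_above_def by blast
    then show ?thesis using maximal[OF _ subset_adjoin] mem_adjoin by blast
  qed
  have "total_module T M"
  proof unfold_locales
    show proper: "- 1 \<notin> M" using M unfolding proper_above_def by blast
    show "a \<in> M \<or> - a \<in> M" if "a \<in> bounded_elements" for a
      using adjoin_proper[OF that proper] adjoin_mem by blast
  qed
  then show thesis using M that unfolding proper_above_def by blast
qed

theorem kadison_dubois:
  assumes f: "f \<in> bounded_elements" and pos: "\<And>\<phi>. nonneg_character T \<phi> \<Longrightarrow> 0 < \<phi> f"
  shows "f \<in> T"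
proof -
  interpret cone: semiring_module T bounded_cone
    by (rule semiring_module_bounded_cone)
  have "- 1 \<in> cone.adjoin (- f)"
  proof (rule ccontr)
    assume "- 1 \<notin> cone.adjoin (- f)"
    then obtain M where M: "cone.adjoin (- f) \<subseteq> M" "total_module T M"
      using proper_module_extends_to_total_module[OF cone.semiring_module_adjoin] by blast
    interpret total_module T M by (rule M)
    interpret nonneg_character T standard_part by (rule nonneg_character_standard_part)
    have "0 \<le> standard_part (- f)"
      using M(1) cone.mem_adjoin f by (blast intro: standard_part_nonneg bounded_elements_uminus)
    then show False
      using pos[OF nonneg_character_standard_part] character_uminus[OF f] by simp
  qed
  then obtain s t where "s \<in> T" "t \<in> bounded_cone" "- 1 = s + (- f) * t"
    unfolding cone.adjoin_def by blast
  then show ?thesis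
    by (intro mem_if_mult_eq_one_plus[OF f]) (auto simp: algebra_simps)
qed

end

section \<open>Polynomials positive on a set in Euclidean space\<close>

instantiation "fun" :: (type, real_vector) real_vector
begin

definition scaleR_fun :: "real \<Rightarrow> ('a \<Rightarrow> 'b) \<Rightarrow> 'a \<Rightarrow> 'b" where
  "scaleR_fun r f = (\<lambda>x. r *\<^sub>R f x)"

instance
  by standard (auto simp: scaleR_fun_def fun_eq_iff algebra_simps)

end

instance "fun" :: (type, real_algebra_1) real_algebra_1
  by standard (auto simp: scaleR_fun_def fun_eq_iff)

lemma of_real_fun: "of_real r = (\<lambda>_. of_real r)"
  by (simp add: of_real_def scaleR_fun_def fun_eq_iff)

lemma sum_fun_apply: "(\<Sum>i\<in>I. f i) x = (\<Sum>i\<in>I. f i x)"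
  by (induction I rule: infinite_finite_induct) simp_all

lemma real_polynomial_function_Basis_induct [consumes 1, case_names inner const add mult]:
  fixes p :: "'a::euclidean_space \<Rightarrow> real"
  assumes "real_polynomial_function p"
    and P_inner: "\<And>b. b \<in> Basis \<Longrightarrow> P (\<lambda>x. x \<bullet> b)" and P_const: "\<And>c. P (\<lambda>_. c)"
    and P_add: "\<And>p q. P p \<Longrightarrow> P q \<Longrightarrow> P (p + q)"
    and P_mult: "\<And>p q. P p \<Longrightarrow> P q \<Longrightarrow> P (p * q)"
  shows "P p"
  using assms(1)
proof (induction p rule: real_polynomial_function.induct)
  case (linear f)
  have "P (\<lambda>x. \<Sum>b\<in>A. (x \<bullet> b) * f b)" if "finite A" "A \<subseteq> Basis" for A
    using that
  proof (induction A rule: finite_induct)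
    case (insert b A)
    then have "P ((\<lambda>x. x \<bullet> b) * (\<lambda>_. f b) + (\<lambda>x. \<Sum>b\<in>A. (x \<bullet> b) * f b))"
      by (intro P_add P_mult P_inner P_const) auto
    then show ?case
      using insert.hyps by (simp add: plus_fun_def times_fun_def)
  qed (simp add: P_const)
  from this[of Basis] have "P (\<lambda>x. \<Sum>b\<in>Basis. (x \<bullet> b) * f b)"
    by simp
  also have "(\<lambda>x. \<Sum>b\<in>Basis. (x \<bullet> b) * f b) = (\<lambda>x. f (\<Sum>b\<in>Basis. (x \<bullet> b) *\<^sub>R b))"
    using bounded_linear.linear[OF linear] by (simp add: linear_sum linear_scale)
  also have "\<dots> = f"
    by (simp only: euclidean_representation)
  finally show ?case .
next
  case (add p q)
  then show ?case using P_add[of p q] by (simp add: plus_fun_def)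
next
  case (mult p q)
  then show ?case using P_mult[of p q] by (simp add: times_fun_def)
qed (rule P_const)

lemma real_polynomial_function_power2_norm:
  "real_polynomial_function (\<lambda>x :: 'a::euclidean_space. (norm x)\<^sup>2)"
proof -
  have "(norm x)\<^sup>2 = (\<Sum>b\<in>Basis. (x \<bullet> b)\<^sup>2)" for x :: 'a
    unfolding power2_norm_eq_inner by (subst euclidean_inner) (simp add: power2_eq_square)
  then show ?thesis
    by (simp only:) (intro real_polynomial_function_sum real_polynomial_function_power
        real_polynomial_function.intros(1) bounded_linear_inner_left finite_Basis)
qed

locale polynomial_semiring = real_semiring T for T :: "('a::euclidean_space \<Rightarrow> real) set" +
  assumes inner_bounded: "b \<in> Basis \<Longrightarrow> (\<lambda>x. x \<bullet> b) \<in> bounded_elements"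
begin

lemma const_bounded: "(\<lambda>_. c) \<in> bounded_elements"
  using bounded_elements_of_real[of c] by (simp add: of_real_fun)

lemma real_polynomial_function_bounded: "real_polynomial_function p \<Longrightarrow> p \<in> bounded_elements"
  by (induction rule: real_polynomial_function_Basis_induct)
    (rule inner_bounded const_bounded bounded_elements_add bounded_elements_mult; assumption)+

lemma nonneg_character_eq_evaluation:
  assumes "nonneg_character T \<phi>"
  obtains w where "\<And>p. real_polynomial_function p \<Longrightarrow> \<phi> p = p w"
proof -
  interpret nonneg_character T \<phi> by (rule assms)
  define w where "w = (\<Sum>b\<in>Basis. \<phi> (\<lambda>x. x \<bullet> b) *\<^sub>R b)"
  have "p \<in> bounded_elements \<and> \<phi> p = p w" if "real_polynomial_function p" for p
    using that
  proof (induction rule: real_polynomial_function_Basis_induct)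
    case (inner b)
    then show ?case by (simp add: w_def inner_bounded)
  next
    case (const c)
    then show ?case using character_of_real[of c] const_bounded by (simp add: of_real_fun)
  next
    case (add p q)
    then show ?case
      using character_add[of p q] bounded_elements_add[of p q] by (simp add: plus_fun_def)
  next
    case (mult p q)
    then show ?case
      using character_mult[of p q] bounded_elements_mult[of p q] by (simp add: times_fun_def)
  qed
  then show thesis using that by blast
qed

theorem archimedean_positivstellensatz:
  assumes p: "real_polynomial_function p"
    and pos: "\<And>w. (\<And>q. q \<in> T \<Longrightarrow> real_polynomial_function q \<Longrightarrow> 0 \<le> q w) \<Longrightarrow> 0 < p w"
  shows "p \<in> T"
proof (rule kadison_dubois)
  show "p \<in> bounded_elements"
    using p by (rule real_polynomial_function_bounded)
  fix \<phi> assume \<phi>: "nonneg_character T \<phi>"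
  then obtain w where w: "\<And>q. real_polynomial_function q \<Longrightarrow> \<phi> q = q w"
    using nonneg_character_eq_evaluation by blast
  have "0 < p w"
  proof (rule pos)
    fix q assume q: "q \<in> T" "real_polynomial_function q"
    then have "0 \<le> \<phi> q"
      using nonneg_character.character_nonneg[OF \<phi>] real_polynomial_function_bounded by blast
    then show "0 \<le> q w" using w q by simp
  qed
  then show "0 < \<phi> p" using w p by simp
qed

end

section \<open>Polynomials in complex coordinates\<close>

lemma polynomial_function_times:
  fixes p q :: "'a::real_normed_vector \<Rightarrow> 'b::{real_normed_algebra, euclidean_space}"
  assumes "polynomial_function p" "polynomial_function q"
  shows "polynomial_function (\<lambda>x. p x * q x)"
proof -
  have "p x * q x = (\<Sum>b\<in>Basis. \<Sum>c\<in>Basis. ((q x \<bullet> c) * (p x \<bullet> b)) *\<^sub>R (b * c))" for x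
  proof -
    have "p x * q x = (\<Sum>b\<in>Basis. (p x \<bullet> b) *\<^sub>R b) * (\<Sum>c\<in>Basis. (q x \<bullet> c) *\<^sub>R c)"
      by (simp only: euclidean_representation)
    then show ?thesis by (simp only: sum_product mult_scaleR_left mult_scaleR_right scaleR_scaleR)
  qed
  moreover have "real_polynomial_function (\<lambda>x. (q x \<bullet> c) * (p x \<bullet> b))" for b c
    using assms
    by (intro real_polynomial_function.intros(4))
      (simp_all add: real_polynomial_function_eq polynomial_function_inner)
  ultimately show ?thesis
    by (simp add: real_polynomial_function_eq polynomial_function_sum polynomial_function_mult)
qed

lemma polynomial_function_power:
  fixes p :: "'a::real_normed_vector \<Rightarrow> 'b::{real_normed_algebra_1, euclidean_space}"
  shows "polynomial_function p \<Longrightarrow> polynomial_function (\<lambda>x. p x ^ n)"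
  by (induction n) (simp_all add: polynomial_function_times)

lemma polynomial_function_prod:
  fixes p :: "'i \<Rightarrow> 'a::real_normed_vector \<Rightarrow> 'b::{real_normed_field, euclidean_space}"
  assumes "\<And>i. i \<in> I \<Longrightarrow> polynomial_function (p i)"
  shows "polynomial_function (\<lambda>x. \<Prod>i\<in>I. p i x)"
  using assms
  by (induction I rule: infinite_finite_induct) (simp_all add: polynomial_function_times)

lemma polynomial_function_zzbar_eval:
  fixes f :: "'n::finite zzbar_poly"
  shows "polynomial_function (zzbar_eval f)"
proof -
  have "bounded_linear (\<lambda>z :: complex ^ 'n. cnj (z $ i))" for i
    by (rule bounded_linear_compose[OF bounded_linear_cnj bounded_linear_vec_nth])
  then have "polynomial_function (\<lambda>z :: complex ^ 'n. monomial_at z \<alpha>)"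
    "polynomial_function (\<lambda>z :: complex ^ 'n. monomial_at (conj_vec z) \<alpha>)" for \<alpha>
    unfolding monomial_at_def conj_vec_def vec_lambda_beta
    by (intro polynomial_function_prod polynomial_function_power polynomial_function_bounded_linear
        bounded_linear_vec_nth)+
  then show ?thesis
    unfolding zzbar_eval_def[abs_def] case_prod_unfold
    by (intro polynomial_function_sum polynomial_function_times) auto
qed

lemma hol_poly_fun_monomial: "hol_poly_fun (\<lambda>z. c * monomial_at z \<alpha>)"
  unfolding hol_poly_fun_def by (rule exI[of _ "Poly_Mapping.single \<alpha> c"]) simp

lemma hol_poly_fun_const: "hol_poly_fun (\<lambda>_. c)"
  using hol_poly_fun_monomial[of c "\<lambda>_. 0"] by (simp add: monomial_at_def)

lemma hol_poly_fun_nth: "hol_poly_fun (\<lambda>z. z $ i)"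
proof -
  have "monomial_at z (\<lambda>j. of_bool (j = i)) = z $ i" for z :: "complex ^ 'a"
    by (simp add: monomial_at_def of_bool_def if_distrib[of "power _"] cong: if_cong)
  then show ?thesis
    using hol_poly_fun_monomial[of 1 "\<lambda>j. of_bool (j = i)"] by simp
qed

lemma hol_poly_fun_add:
  assumes "hol_poly_fun h" "hol_poly_fun k"
  shows "hol_poly_fun (\<lambda>z. h z + k z)"
proof -
  obtain c d where
    "\<And>z. h z = (\<Sum>\<alpha>\<in>Poly_Mapping.keys c. Poly_Mapping.lookup c \<alpha> * monomial_at z \<alpha>)"
    "\<And>z. k z = (\<Sum>\<alpha>\<in>Poly_Mapping.keys d. Poly_Mapping.lookup d \<alpha> * monomial_at z \<alpha>)"
    using assms unfolding hol_poly_fun_def by blast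
  then show ?thesis
    unfolding hol_poly_fun_def
    by (intro exI[of _ "c + d"] allI)
      (simp add: setsum_keys_plus_distrib[where f = "\<lambda>\<alpha> x. x * monomial_at _ \<alpha>"] distrib_right)
qed

lemma hol_poly_fun_sum:
  "(\<And>i. i \<in> I \<Longrightarrow> hol_poly_fun (h i)) \<Longrightarrow> hol_poly_fun (\<lambda>z. \<Sum>i\<in>I. h i z)"
  by (induction I rule: infinite_finite_induct) (simp_all add: hol_poly_fun_const hol_poly_fun_add)

lemma monomial_at_mult: "monomial_at z \<alpha> * monomial_at z \<beta> = monomial_at z (\<lambda>i. \<alpha> i + \<beta> i)"
  by (simp add: monomial_at_def power_add prod.distrib)

lemma hol_poly_fun_mult:
  assumes "hol_poly_fun h" "hol_poly_fun k"
  shows "hol_poly_fun (\<lambda>z. h z * k z)"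
proof -
  obtain c d where
    h: "\<And>z. h z = (\<Sum>\<alpha>\<in>Poly_Mapping.keys c. Poly_Mapping.lookup c \<alpha> * monomial_at z \<alpha>)" and
    k: "\<And>z. k z = (\<Sum>\<beta>\<in>Poly_Mapping.keys d. Poly_Mapping.lookup d \<beta> * monomial_at z \<beta>)"
    using assms unfolding hol_poly_fun_def by blast
  have "h z * k z = (\<Sum>\<alpha>\<in>Poly_Mapping.keys c. \<Sum>\<beta>\<in>Poly_Mapping.keys d.
      (Poly_Mapping.lookup c \<alpha> * Poly_Mapping.lookup d \<beta>) * monomial_at z (\<lambda>i. \<alpha> i + \<beta> i))" for z
    unfolding h k sum_product monomial_at_mult[symmetric] by (simp add: mult_ac)
  then show ?thesis
    by (simp only: hol_poly_fun_sum hol_poly_fun_monomial)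
qed

section \<open>Squared norms on the sphere\<close>

lemma cnorm_power2: "(cnorm N w)\<^sup>2 = (\<Sum>j<N. (cmod (w j))\<^sup>2)"
  by (simp add: cnorm_def L2_set_def sum_nonneg)

inductive_set sphere_squared_norms :: "(complex ^ 'n::finite \<Rightarrow> real) set" where
  square: "hol_poly_fun h \<Longrightarrow> (\<lambda>z. (cmod (h z))\<^sup>2) \<in> sphere_squared_norms"
| add: "F \<in> sphere_squared_norms \<Longrightarrow> G \<in> sphere_squared_norms \<Longrightarrow> F + G \<in> sphere_squared_norms"
| cong: "F \<in> sphere_squared_norms \<Longrightarrow> (\<And>z. norm z = 1 \<Longrightarrow> F z = G z) \<Longrightarrow> G \<in> sphere_squared_norms"

lemma sphere_squared_norms_square_mult:
  assumes "G \<in> sphere_squared_norms" "hol_poly_fun h"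
  shows "(\<lambda>z. (cmod (h z))\<^sup>2) * G \<in> sphere_squared_norms"
  using assms(1)
proof induction
  case (square k)
  then show ?case
    using sphere_squared_norms.square[OF hol_poly_fun_mult[OF assms(2) square]]
    by (simp add: times_fun_def norm_mult power_mult_distrib)
next
  case (add F G)
  from sphere_squared_norms.add[OF add.IH] show ?case
    by (simp add: plus_fun_def times_fun_def distrib_left)
next
  case (cong F G)
  from cong.IH show ?case
    by (rule sphere_squared_norms.cong) (simp add: cong.hyps)
qed

lemma sphere_squared_norms_mult:
  assumes "F \<in> sphere_squared_norms" "G \<in> sphere_squared_norms"
  shows "F * G \<in> sphere_squared_norms"
  using assms(1)
proof induction
  case (square h)
  with assms(2) show ?case by (rule sphere_squared_norms_square_mult)
next
  case (add F F')
  from sphere_squared_norms.add[OF add.IH] show ?case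
    by (simp add: plus_fun_def times_fun_def distrib_right)
next
  case (cong F F')
  from cong.IH show ?case
    by (rule sphere_squared_norms.cong) (simp add: cong.hyps)
qed

lemma sphere_squared_norms_of_real:
  assumes "0 \<le> r"
  shows "of_real r \<in> sphere_squared_norms"
  using sphere_squared_norms.square[OF hol_poly_fun_const[of "of_real (sqrt r)"]] assms
  by (simp add: of_real_fun)

lemma sphere_squared_norms_hol_poly_map:
  assumes "F \<in> sphere_squared_norms"
  obtains N g where "1 \<le> N" "hol_poly_map N g" "\<And>z. norm z = 1 \<Longrightarrow> F z = (cnorm N (g z))\<^sup>2"
proof -
  have "\<exists>N g. 1 \<le> N \<and> hol_poly_map N g \<and> (\<forall>z. norm z = 1 \<longrightarrow> F z = (cnorm N (g z))\<^sup>2)"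
    using assms
  proof induction
    case (square h)
    then show ?case
      by (intro exI[of _ 1] exI[of _ "\<lambda>z _. h z"]) (simp add: hol_poly_map_def cnorm_power2)
  next
    case (add F G)
    then obtain N g M h where N: "1 \<le> N" and "hol_poly_map N g" "hol_poly_map M h"
      and F: "\<And>z. norm z = 1 \<Longrightarrow> F z = (cnorm N (g z))\<^sup>2"
      and G: "\<And>z. norm z = 1 \<Longrightarrow> G z = (cnorm M (h z))\<^sup>2"
      by blast
    define gh where "gh z j = (if j < N then g z j else h z (j - N))" for z j
    have "hol_poly_fun (\<lambda>z. gh z j)" if "j < N + M" for j
      using \<open>hol_poly_map N g\<close> \<open>hol_poly_map M h\<close> that
      by (cases "j < N") (simp_all add: hol_poly_map_def gh_def)
    then have "hol_poly_map (N + M) gh"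
      unfolding hol_poly_map_def by blast
    moreover have "(cnorm (N + M) (gh z))\<^sup>2 = (cnorm N (g z))\<^sup>2 + (cnorm M (h z))\<^sup>2" for z
      unfolding cnorm_power2 gh_def by (induction M) simp_all
    ultimately show ?case
      using N F G by (intro exI[of _ "N + M"] exI[of _ gh]) simp
  next
    case (cong F G)
    then show ?case by metis
  qed
  then show thesis using that by blast
qed

interpretation sphere: real_semiring sphere_squared_norms
  by unfold_locales
    (rule sphere_squared_norms.add sphere_squared_norms_mult sphere_squared_norms_of_real;
      assumption)+

lemma power2_norm_vec: "(norm x)\<^sup>2 = (\<Sum>i\<in>UNIV. (norm (x $ i))\<^sup>2)"
  by (simp add: norm_vec_def L2_set_def sum_nonneg)

lemma one_plus_inner_nth_sphere_squared_norm:
  assumes "cmod c = 1"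
  shows "(\<lambda>z. 1 + z $ i \<bullet> c) \<in> sphere_squared_norms"
proof (rule sphere_squared_norms.cong)
  let ?F = "(\<lambda>z. (cmod (1 + cnj c * z $ i))\<^sup>2) + (\<Sum>j\<in>UNIV - {i}. (\<lambda>z. (cmod (z $ j))\<^sup>2))"
  show "of_real (1/2) * ?F \<in> sphere_squared_norms"
    by (intro sphere.mult_mem sphere.of_real_mem sphere.add_mem sphere.sum_mem
        sphere_squared_norms.square hol_poly_fun_add hol_poly_fun_mult hol_poly_fun_const
        hol_poly_fun_nth) simp
  fix z :: "complex ^ 'a" assume z: "norm z = 1"
  have "(\<Sum>j\<in>UNIV - {i}. (\<lambda>z. (cmod (z $ j))\<^sup>2)) z = 1 - (cmod (z $ i))\<^sup>2"
    using power2_norm_vec[of z] z by (simp add: sum_fun_apply sum_diff1)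
  moreover have "(cmod (1 + cnj c * x))\<^sup>2 = 1 + 2 * (x \<bullet> c) + (cmod x)\<^sup>2" for x
  proof -
    have "(cmod (1 + cnj c * x))\<^sup>2 = 1 + 2 * Re (cnj c * x) + (cmod (cnj c * x))\<^sup>2"
      unfolding cmod_power2 by (simp add: power2_eq_square algebra_simps)
    then show ?thesis using assms by (simp add: norm_mult inner_complex_def mult.commute)
  qed
  ultimately show "(of_real (1/2) * ?F) z = 1 + z $ i \<bullet> c"
    by (simp add: of_real_fun)
qed

interpretation sphere: polynomial_semiring sphere_squared_norms
proof
  fix b :: "complex ^ 'n" assume "b \<in> Basis"
  then obtain i c where b: "b = axis i c" and c: "c \<in> Basis"
    unfolding Basis_vec_def by blast
  have "1 + (\<lambda>z. z \<bullet> b) = (\<lambda>z. 1 + z $ i \<bullet> c)"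
    "1 - (\<lambda>z. z \<bullet> b) = (\<lambda>z. 1 + z $ i \<bullet> (- c))"
    by (simp_all add: b inner_axis fun_eq_iff)
  then have "of_real 1 - (\<lambda>z. z \<bullet> b) \<in> sphere_squared_norms"
    "of_real 1 + (\<lambda>z. z \<bullet> b) \<in> sphere_squared_norms"
    using one_plus_inner_nth_sphere_squared_norm[of c i]
      one_plus_inner_nth_sphere_squared_norm[of "- c" i] norm_Basis[OF c] by simp_all
  then show "(\<lambda>z. z \<bullet> b) \<in> sphere.bounded_elements"
    unfolding sphere.bounded_elements_def by blast
qed

lemma norm_eq_1_if_sphere_squared_norms_nonneg:
  fixes w :: "complex ^ 'n::finite"
  assumes nonneg: "\<And>q. q \<in> sphere_squared_norms \<Longrightarrow> real_polynomial_function q \<Longrightarrow> 0 \<le> q w"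
  shows "norm w = 1"
proof -
  have "of_real 0 \<in> sphere_squared_norms"
    by (rule sphere.of_real_mem) simp
  then have "(\<lambda>z :: complex ^ 'n. (norm z)\<^sup>2 - 1) \<in> sphere_squared_norms"
    "(\<lambda>z :: complex ^ 'n. 1 - (norm z)\<^sup>2) \<in> sphere_squared_norms"
    by (rule sphere_squared_norms.cong; simp)+
  from this[THEN nonneg] have "(norm w)\<^sup>2 = 1"
    using real_polynomial_function_power2_norm by force
  then show ?thesis
    using norm_ge_zero[of w] by (simp add: power2_eq_1_iff)
qed

theorem theorem3:
  fixes f :: "'n::finite zzbar_poly" and m :: nat
  assumes "zzbar_degree f = m"
    and "zzbar_real_valued f"
    and "\<And>z :: complex ^ 'n. norm z = 1 \<Longrightarrow> Re (zzbar_eval f z) > 0"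
  shows "\<exists>(N::nat) (g :: complex ^ 'n \<Rightarrow> nat \<Rightarrow> complex).
    N \<ge> 1 \<and> hol_poly_map N g \<and>
    (\<forall>z. norm z = 1 \<longrightarrow> zzbar_eval f z = complex_of_real ((cnorm N (g z))\<^sup>2))"
proof -
  have "real_polynomial_function (\<lambda>z. Re (zzbar_eval f z))"
    using polynomial_function_zzbar_eval[of f] bounded_linear_Re
    unfolding polynomial_function_def o_def by blast
  then have "(\<lambda>z. Re (zzbar_eval f z)) \<in> sphere_squared_norms"
    by (rule sphere.archimedean_positivstellensatz)
      (rule assms(3), rule norm_eq_1_if_sphere_squared_norms_nonneg)
  then obtain N g where "1 \<le> N" "hol_poly_map N g"
    and Re_f: "\<And>z. norm z = 1 \<Longrightarrow> Re (zzbar_eval f z) = (cnorm N (g z))\<^sup>2"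
    by (rule sphere_squared_norms_hol_poly_map) blast
  moreover have "zzbar_eval f z = complex_of_real ((cnorm N (g z))\<^sup>2)" if "norm z = 1" for z
    using assms(2) unfolding zzbar_real_valued_def Re_f[OF that, symmetric] by simp
  ultimately show ?thesis by blast
qed

end
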